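(* Let $\gamma_0>0$, $\gamma_1>\gamma_2$ and $M_r=M_b=M$. Then the system $$0=\frac{rb}{1-\rho}+\frac{\gamma_1+\gamma_2}{2}\,\partial_y\!\left(\frac{rb}{1-\rho}\right)+\gamma_0\,\partial_y\!\left(\frac{r}{1-\rho}\right),$$ $$0=-\frac{rb}{1-\rho}+\frac{\gamma_1+\gamma_2}{2}\,\partial_y\!\left(\frac{rb}{1-\rho}\right)+\gamma_0\,\partial_y\!\left(\frac{b}{1-\rho}\right),$$ where $\rho=r+b$, has non-trivial stationary states, and any stationary solution constant in the $x$-direction exhibits weak lane formation.
   Context: Setting: $\Omega=[-L_x,L_x]\times[-L_y,L_y]$ is a corridor, and $0\le\gamma_0,\gamma_1,\gamma_2\le1$. The densities $r,b\ge0$ of two pedestrian groups moving in opposite $x$-directions evolve on $\Omega$ with periodic boundary conditions in $x$ and no flux at $y=\pm L_y$. The displayed system is the one satisfied, when $\rho<1$, by stationary states of this evolution that do not depend on $x$, regarded as functions of $y\in[-L_y,L_y]$; it was derived in the regime $\gamma_1-\gamma_2=\mathcal O(h)$ ($h>0$ the lattice size), where without loss of generality $\gamma_1-\gamma_2$ was set equal to $h$. The masses are $M_r=\int_\Omega r\,dx\,dy$ and $M_b=\int_\Omega b\,dx\,dy$. A trivial solution curve is one consisting of only one stationary point lying on one of the axes $r=0$ or $b=0$. Weak lane formation: for $\gamma_1>\gamma_2$, an $x$-independent stationary solution $(r,b)$, considered as a function of $y$ only, is a solution with weak lane formation if it is sufficiently smooth and satisfies $\partial_y r<0$ and $\partial_y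 b>0$, and there exists a point $\tilde y\in(-L_y,L_y)$ such that $r(\tilde y)=b(\tilde y)$. *)

theory Defs
  imports "HOL-Analysis.Analysis"
begin

definition corridor :: "real \<Rightarrow> real \<Rightarrow> (real \<times> real) set" where
  "corridor Lx Ly = {-Lx..Lx} \<times> {-Ly..Ly}"

definition mass :: "real \<Rightarrow> real \<Rightarrow> (real \<times> real \<Rightarrow> real) \<Rightarrow> real" where
  "mass Lx Ly f = integral (corridor Lx Ly) f"

definition x_independent :: "real \<Rightarrow> real \<Rightarrow> (real \<times> real \<Rightarrow> real) \<Rightarrow> bool" where
  "x_independent Lx Ly f \<longleftrightarrow>
     (\<forall>x\<in>{-Lx..Lx}. \<forall>x'\<in>{-Lx..Lx}. \<forall>y\<in>{-Ly..Ly}. f (x, y) = f (x', y))"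

text \<open>An x-independent field on the corridor, regarded as a function of y only; the choice of
  the section x = 0 is immaterial for such fields.\<close>

definition profile :: "(real \<times> real \<Rightarrow> real) \<Rightarrow> real \<Rightarrow> real" where
  "profile f = (\<lambda>y. f (0, y))"

text \<open>The derivative with respect to y on the closed interval, one-sided at the walls.
  It is only meaningful where the function is differentiable, which is required
  separately wherever it is used.\<close>

definition dy :: "real \<Rightarrow> (real \<Rightarrow> real) \<Rightarrow> real \<Rightarrow> real" where
  "dy Ly f y = vector_derivative f (at y within {-Ly..Ly})"

text \<open>The two equations state that the y-components of the fluxes vanish on the whole closed
  interval, so the no-flux condition at the walls is included. Periodicity in x is automatic
  for x-independent fields. Since the total density is below 1, differentiability of the
  two densities gives differentiability of all the quotients.\<close>

definition stationary_profile ::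
  "real \<Rightarrow> real \<Rightarrow> real \<Rightarrow> real \<Rightarrow> (real \<Rightarrow> real) \<Rightarrow> (real \<Rightarrow> real) \<Rightarrow> bool" where
  "stationary_profile Ly \<gamma>\<^sub>0 \<gamma>\<^sub>1 \<gamma>\<^sub>2 r b \<longleftrightarrow>
     (let \<rho> = (\<lambda>y. r y + b y) in
      \<forall>y\<in>{-Ly..Ly}.
        0 \<le> r y \<and> 0 \<le> b y \<and> \<rho> y < 1 \<and>
        r differentiable (at y within {-Ly..Ly}) \<and>
        b differentiable (at y within {-Ly..Ly}) \<and>
        0 = r y * b y / (1 - \<rho> y)
            + (\<gamma>\<^sub>1 + \<gamma>\<^sub>2) / 2 * dy Ly (\<lambda>t. r t * b t / (1 - \<rho> t)) y
            + \<gamma>\<^sub>0 * dy Ly (\<lambda>t. r t / (1 - \<rho> t)) y \<and>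
        0 = - (r y * b y / (1 - \<rho> y))
            + (\<gamma>\<^sub>1 + \<gamma>\<^sub>2) / 2 * dy Ly (\<lambda>t. r t * b t / (1 - \<rho> t)) y
            + \<gamma>\<^sub>0 * dy Ly (\<lambda>t. b t / (1 - \<rho> t)) y)"

definition x_independent_stationary_state ::
  "real \<Rightarrow> real \<Rightarrow> real \<Rightarrow> real \<Rightarrow> real \<Rightarrow>
   (real \<times> real \<Rightarrow> real) \<Rightarrow> (real \<times> real \<Rightarrow> real) \<Rightarrow> bool" where
  "x_independent_stationary_state Lx Ly \<gamma>\<^sub>0 \<gamma>\<^sub>1 \<gamma>\<^sub>2 r b \<longleftrightarrow>
     x_independent Lx Ly r \<and> x_independent Lx Ly b \<and>
     stationary_profile Ly \<gamma>\<^sub>0 \<gamma>\<^sub>1 \<gamma>\<^sub>2 (profile r) (profile b)"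

text \<open>Triviality refers to the solution curve in the (r,b) phase plane.\<close>

definition trivial_state ::
  "real \<Rightarrow> (real \<times> real \<Rightarrow> real) \<Rightarrow> (real \<times> real \<Rightarrow> real) \<Rightarrow> bool" where
  "trivial_state Ly r b \<longleftrightarrow>
     (\<exists>p. (\<lambda>y. (profile r y, profile b y)) ` {-Ly..Ly} = {p} \<and> (fst p = 0 \<or> snd p = 0))"

text \<open>Derivatives of all orders exist on the set (\<open>D n\<close> is the n-th one), one-sided at the
  endpoints of a closed interval.\<close>

definition smooth_on :: "real set \<Rightarrow> (real \<Rightarrow> real) \<Rightarrow> bool" where
  "smooth_on S f \<longleftrightarrow>
     (\<exists>D :: nat \<Rightarrow> real \<Rightarrow> real.
        (\<forall>y\<in>S. D 0 y = f y) \<and>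
        (\<forall>n. \<forall>y\<in>S. (D n has_real_derivative D (Suc n) y) (at y within S)))"

definition weak_lane_formation ::
  "real \<Rightarrow> (real \<times> real \<Rightarrow> real) \<Rightarrow> (real \<times> real \<Rightarrow> real) \<Rightarrow> bool" where
  "weak_lane_formation Ly r b \<longleftrightarrow>
     smooth_on {-Ly..Ly} (profile r) \<and> smooth_on {-Ly..Ly} (profile b) \<and>
     (\<forall>y\<in>{-Ly..Ly}. dy Ly (profile r) y < 0 \<and> dy Ly (profile b) y > 0) \<and>
     (\<exists>y\<in>{-Ly<..<Ly}. profile r y = profile b y)"

end

theory Submission
  imports Defs
begin

text \<open>
  Put \<open>P = r/(1-\<rho>)\<close>, \<open>Q = b/(1-\<rho>)\<close>, \<open>F = rb/(1-\<rho>) = PQ/(1+P+Q)\<close> and \<open>c = (\<gamma>\<^sub>1+\<gamma>\<^sub>2)/2 > 0\<close>. The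
  system becomes \<open>F + cF' + \<gamma>\<^sub>0P' = 0\<close>, \<open>-F + cF' + \<gamma>\<^sub>0Q' = 0\<close>. Everything follows from two ways of
  reading it.

  Lane formation. Solved for the derivatives, the system is autonomous with a rational right-hand
  side, so solutions are smooth, and it implies a linear equation \<open>F' = hF\<close>. If \<open>F\<close> vanishes
  somewhere, then it vanishes everywhere, \<open>P\<close> and \<open>Q\<close> are constant and one of the groups is absent,
  contrary to its positive mass (\<open>interaction_zero_imp_one_group_absent\<close>). Hence \<open>F > 0\<close>, and the
  formulas for \<open>r'\<close> and \<open>b'\<close> (\<open>deriv_r\<close>, \<open>deriv_b\<close>) have a manifest sign. Equal masses force the two
  densities to cross inside the corridor (\<open>densities_cross\<close>).

  Existence. With \<open>s = P+Q\<close> and \<open>d = P-Q\<close>, sum and difference of the equations read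
  \<open>(2cF + \<gamma>\<^sub>0s)' = 0\<close> and \<open>\<gamma>\<^sub>0d' = -2F\<close>. On the level \<open>2cF + \<gamma>\<^sub>0s = \<gamma>\<^sub>0\<kappa>\<close> the quantity \<open>s\<close> is an even
  algebraic function of \<open>d\<close>, and only the scalar equation \<open>d' = -(\<kappa>-s)/c\<close> is left. The substitution
  \<open>d = -\<kappa> tanh \<theta>\<close> makes it \<open>\<theta>' = 1/\<Lambda>\<close> with \<open>\<Lambda>\<close> even and bounded below, which has an odd global
  solution depending continuously on \<open>\<kappa>\<close> (\<open>separable_ode_with_parameter\<close>). Oddness makes the two
  masses equal, and as \<open>\<kappa>\<close> runs through \<open>(0,\<infinity>)\<close> their sum takes every value between \<open>0\<close> and the area of
  the corridor (\<open>stationary_profile_with_mass\<close>).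
\<close>

section \<open>Separable equations with a parameter\<close>

text \<open>The equation \<open>\<Theta>' = 1 / \<Lambda>\<^sub>k(\<Theta>)\<close>, \<open>\<Theta>(0) = 0\<close> is solved by inverting the travel time
  \<open>Y\<^sub>k(x) = \<integral>\<^sub>0\<^sup>x \<Lambda>\<^sub>k\<close>. The lower bound on \<open>\<Lambda>\<close> makes \<open>Y\<^sub>k\<close> a bijection of the line whose inverse
  is Lipschitz with constant \<open>1/c\<close> for every \<open>k\<close>, and this uniformity gives continuity in \<open>k\<close>
  and \<open>y\<close> jointly.\<close>

lemma separable_ode_with_parameter:
  fixes \<Lambda> :: "real \<Rightarrow> real \<Rightarrow> real"
  assumes cont: "continuous_on (U \<times> UNIV) (\<lambda>(k, x). \<Lambda> k x)"
    and c: "c > 0" and lower: "\<And>k x. k \<in> U \<Longrightarrow> c \<le> \<Lambda> k x"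
    and even: "\<And>k x. k \<in> U \<Longrightarrow> \<Lambda> k (- x) = \<Lambda> k x"
  obtains \<Theta> where "continuous_on (U \<times> UNIV) (\<lambda>(k, y). \<Theta> k y)"
    and "\<And>k y. k \<in> U \<Longrightarrow> (\<Theta> k has_real_derivative 1 / \<Lambda> k (\<Theta> k y)) (at y)"
    and "\<And>k y. k \<in> U \<Longrightarrow> \<Theta> k (- y) = - \<Theta> k y"
proof -
  \<comment> \<open>Scaling the integral to the unit interval covers both signs of \<open>x\<close> and makes \<open>Y k\<close> visibly odd.\<close>
  define Y where "Y k x = x * integral {0..1} (\<lambda>t. \<Lambda> k (x * t))" for k x
  have cont_comp: "continuous_on A (\<lambda>z. \<Lambda> (f z) (h z))"
    if "continuous_on A f" "continuous_on A h" "f ` A \<subseteq> U"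
    for A :: "(real \<times> real) set" and f h
    using continuous_on_compose2[OF cont continuous_on_Pair[OF that(1,2)]] that(3) by auto
  have cont_Y: "continuous_on U (\<lambda>k. Y k x)" for x
  proof -
    have "continuous_on (U \<times> cbox 0 1) (\<lambda>(k, t). \<Lambda> k (x * t))"
      unfolding case_prod_unfold by (intro cont_comp continuous_intros) auto
    from integral_continuous_on_param[OF this] show ?thesis
      unfolding Y_def by (intro continuous_intros) simp
  qed
  have cont_\<Lambda>: "continuous_on A (\<Lambda> k)" if "k \<in> U" for k A
    using continuous_on_compose2[OF cont, of A "\<lambda>x. (k, x)"] that
    by (auto simp: continuous_on_Pair)
  have deriv_Y: "(Y k has_real_derivative \<Lambda> k x) (at x)" if k: "k \<in> U" for k x
  proof -
    define R where "R = \<bar>x\<bar> + 1"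
    define G where "G z = integral {-R..z} (\<Lambda> k)" for z
    have G: "(G has_real_derivative \<Lambda> k z) (at z within {-R..R})" if "z \<in> {-R..R}" for z
      unfolding G_def using integral_has_real_derivative[OF cont_\<Lambda>[OF k] that] .
    have Y_eq: "Y k z = G z - G 0" if z: "z \<in> {-R..R}" for z
    proof -
      have "((\<lambda>t. \<Lambda> k (z * t) * z) has_integral (G (z * 1) - G (z * 0))) {0..1}"
      proof (rule fundamental_theorem_of_calculus)
        fix t :: real assume t: "t \<in> {0..1}"
        have "\<bar>z * t'\<bar> \<le> R" if "t' \<in> {0..1}" for t'
          using z that mult_mono[of "\<bar>z\<bar>" R "\<bar>t'\<bar>" 1] by (auto simp: abs_mult R_def)
        then have in_R: "(\<lambda>t. z * t) ` {0..1} \<subseteq> {-R..R}"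
          by (force simp: abs_le_iff)
        have "(G has_real_derivative \<Lambda> k (z * t)) (at (z * t) within (\<lambda>t. z * t) ` {0..1})"
          using in_R t by (intro has_field_derivative_subset[OF G in_R]) blast
        moreover have "((\<lambda>t. z * t) has_real_derivative z) (at t within {0..1})"
          by (auto intro!: derivative_eq_intros)
        ultimately have "((\<lambda>t. G (z * t)) has_real_derivative \<Lambda> k (z * t) * z) (at t within {0..1})"
          using DERIV_image_chain[of G] by (simp add: o_def)
        then show "((\<lambda>t. G (z * t)) has_vector_derivative \<Lambda> k (z * t) * z) (at t within {0..1})"
          by (simp add: has_real_derivative_iff_has_vector_derivative)
      qed simp
      then have "integral {0..1} (\<lambda>t. \<Lambda> k (z * t) * z) = G (z * 1) - G (z * 0)"
        by (rule integral_unique)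
      then show ?thesis
        by (simp add: Y_def mult.commute)
    qed
    have x: "x \<in> {-R..R}" and x': "x \<in> {-R<..<R}" and sub: "{-R<..<R} \<subseteq> {-R..R}"
      by (auto simp: R_def)
    have "((\<lambda>z. G z - G 0) has_real_derivative \<Lambda> k x) (at x within {-R<..<R})"
      using DERIV_diff[OF has_field_derivative_subset[OF G[OF x] sub] DERIV_const, of "G 0"] by simp
    then have "(Y k has_real_derivative \<Lambda> k x) (at x within {-R<..<R})"
      by (rule has_field_derivative_transform_within[where d = 1]) (auto simp: Y_eq R_def)
    then show ?thesis
      by (simp only: at_within_open[OF x' open_greaterThanLessThan])
  qed
  have growth: "c * (x' - x) \<le> Y k x' - Y k x" if k: "k \<in> U" and "x \<le> x'" for k x x'
  proof -
    have "Y k x - c * x \<le> Y k x' - c * x'"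
    proof (rule DERIV_nonneg_imp_nondecreasing[OF \<open>x \<le> x'\<close>])
      fix z
      have "((\<lambda>z. Y k z - c * z) has_real_derivative \<Lambda> k z - c) (at z)"
        by (auto intro!: derivative_eq_intros deriv_Y k)
      then show "\<exists>D. ((\<lambda>z. Y k z - c * z) has_real_derivative D) (at z) \<and> 0 \<le> D"
        using lower[OF k, of z] by (intro exI[of _ "\<Lambda> k z - c"]) auto
    qed
    then show ?thesis by (simp add: algebra_simps)
  qed
  have expand: "c * \<bar>x' - x\<bar> \<le> \<bar>Y k x' - Y k x\<bar>" if k: "k \<in> U" for k x x'
    using growth[OF k, of x x'] growth[OF k, of x' x] by (cases "x \<le> x'") auto
  have Y0: "Y k 0 = 0" for k
    by (simp add: Y_def)
  have "\<exists>x. Y k x = y" if k: "k \<in> U" for k y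
  proof -
    let ?a = "\<bar>y\<bar> / c"
    have "\<exists>x. - ?a \<le> x \<and> x \<le> ?a \<and> Y k x = y"
    proof (rule IVT')
      show "Y k (- ?a) \<le> y" "y \<le> Y k ?a" "- ?a \<le> ?a"
        using growth[OF k, of "- ?a" 0] growth[OF k, of 0 ?a] c by (auto simp: Y0)
      show "continuous_on {- ?a..?a} (Y k)"
        by (intro continuous_at_imp_continuous_on ballI DERIV_isCont[OF deriv_Y[OF k]])
    qed
    then show ?thesis by auto
  qed
  then obtain \<Theta> where Y_\<Theta>: "Y k (\<Theta> k y) = y" if "k \<in> U" for k y
    by metis
  \<comment> \<open>Here \<open>k\<close> and \<open>y\<close> may move while \<open>x\<close> stays fixed, so continuity of \<open>Y\<close> in \<open>k\<close> at fixed \<open>x\<close> controls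
    the inverse jointly.\<close>
  have near: "\<bar>\<Theta> k y - x\<bar> \<le> \<bar>y - Y k x\<bar> / c" if "k \<in> U" for k y x
    using expand[OF that, of "\<Theta> k y" x] c by (simp add: Y_\<Theta>[OF that] field_simps)
  have cont_\<Theta>: "continuous_on (U \<times> UNIV) (\<lambda>(k, y). \<Theta> k y)"
    unfolding continuous_on_def
  proof safe
    fix k0 y0 assume k0: "k0 \<in> U"
    define x0 where "x0 = \<Theta> k0 y0"
    have "continuous_on (U \<times> UNIV) (\<lambda>z. \<bar>snd z - Y (fst z) x0\<bar> / c)"
      by (intro continuous_intros continuous_on_compose2[OF cont_Y]) (use c in auto)
    then have "((\<lambda>z. \<bar>snd z - Y (fst z) x0\<bar> / c) \<longlongrightarrow> \<bar>y0 - Y k0 x0\<bar> / c)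
        (at (k0, y0) within U \<times> UNIV)"
      using k0 unfolding continuous_on_def by fastforce
    then have "((\<lambda>z. \<bar>snd z - Y (fst z) x0\<bar> / c) \<longlongrightarrow> 0) (at (k0, y0) within U \<times> UNIV)"
      by (simp add: x0_def Y_\<Theta>[OF k0])
    then have "((\<lambda>z. \<Theta> (fst z) (snd z) - x0) \<longlongrightarrow> 0) (at (k0, y0) within U \<times> UNIV)"
      by (rule Lim_null_comparison[rotated])
         (auto simp: eventually_at_filter near intro!: always_eventually)
    then show "((\<lambda>(k, y). \<Theta> k y) \<longlongrightarrow> \<Theta> k0 y0) (at (k0, y0) within U \<times> UNIV)"
      by (simp add: x0_def LIM_zero_iff case_prod_unfold)
  qed
  show thesis
  proof
    show "continuous_on (U \<times> UNIV) (\<lambda>(k, y). \<Theta> k y)"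
      by (fact cont_\<Theta>)
    fix k y assume k: "k \<in> U"
    have "continuous_on UNIV (\<Theta> k)"
      using continuous_on_compose2[OF cont_\<Theta>, of UNIV "\<lambda>x. (k, x)"] k
      by (auto simp: continuous_on_Pair)
    then have "isCont (\<Theta> k) y"
      by (simp add: continuous_on_eq_continuous_at)
    moreover have "\<Lambda> k (\<Theta> k y) \<noteq> 0"
      using lower[OF k, of "\<Theta> k y"] c by auto
    ultimately show "(\<Theta> k has_real_derivative 1 / \<Lambda> k (\<Theta> k y)) (at y)"
      using DERIV_inverse_function[OF deriv_Y[OF k], of "\<Theta> k" y "y - 1" "y + 1"]
      by (simp add: Y_\<Theta>[OF k] inverse_eq_divide)
    have "Y k (- \<Theta> k y) = - y"
      using Y_\<Theta>[OF k, of y] even[OF k] by (simp add: Y_def)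
    then show "\<Theta> k (- y) = - \<Theta> k y"
      using near[OF k, of "- y" "- \<Theta> k y"] by simp
  qed
qed

section \<open>Smoothness on a closed interval\<close>

text \<open>Differentiability up to order \<open>n\<close>, with one-sided derivatives at the ends of an interval. The
  recursion on a witness for the derivative makes the closure properties short inductions,
  without a Leibniz formula.\<close>

primrec k_times_differentiable_on :: "real set \<Rightarrow> nat \<Rightarrow> (real \<Rightarrow> real) \<Rightarrow> bool" where
  "k_times_differentiable_on S 0 f = True"
| "k_times_differentiable_on S (Suc n) f =
     (\<exists>f'. (\<forall>y\<in>S. (f has_real_derivative f' y) (at y within S)) \<and> k_times_differentiable_on S n f')"

lemma k_times_differentiable_on_SucE:
  assumes "k_times_differentiable_on S (Suc n) f"
  obtains f' where "\<And>y. y \<in> S \<Longrightarrow> (f has_real_derivative f' y) (at y within S)"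
    and "k_times_differentiable_on S n f'"
  using assms by auto

lemma k_times_differentiable_on_SucI:
  assumes "\<And>y. y \<in> S \<Longrightarrow> (f has_real_derivative f' y) (at y within S)"
    and "k_times_differentiable_on S n f'"
  shows "k_times_differentiable_on S (Suc n) f"
  using assms by auto

declare k_times_differentiable_on.simps(2) [simp del]

lemma k_times_differentiable_on_cong:
  assumes "k_times_differentiable_on S n f" "\<And>y. y \<in> S \<Longrightarrow> f y = h y"
  shows "k_times_differentiable_on S n h"
proof (cases n)
  case (Suc m)
  obtain f' where f': "\<And>y. y \<in> S \<Longrightarrow> (f has_real_derivative f' y) (at y within S)"
    "k_times_differentiable_on S m f'"
    using assms(1) unfolding Suc by (rule k_times_differentiable_on_SucE) blast
  have "(h has_real_derivative f' y) (at y within S)" if "y \<in> S" for y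
    by (rule has_field_derivative_transform_within[OF f'(1)[OF that] zero_less_one that])
       (simp add: assms(2))
  from k_times_differentiable_on_SucI[OF this f'(2)] show ?thesis
    unfolding Suc .
qed simp

lemma k_times_differentiable_on_Suc_imp:
  "k_times_differentiable_on S (Suc n) f \<Longrightarrow> k_times_differentiable_on S n f"
proof (induction n arbitrary: f)
  case (Suc n)
  from Suc.prems obtain f' where f':
    "\<And>y. y \<in> S \<Longrightarrow> (f has_real_derivative f' y) (at y within S)"
    "k_times_differentiable_on S (Suc n) f'"
    by (rule k_times_differentiable_on_SucE) blast
  show ?case
    by (rule k_times_differentiable_on_SucI[OF f'(1) Suc.IH[OF f'(2)]])
qed simp

lemma k_times_differentiable_on_const: "k_times_differentiable_on S n (\<lambda>y. a)"
proof (induction n arbitrary: a)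
  case (Suc n)
  show ?case
    by (rule k_times_differentiable_on_SucI[OF DERIV_const Suc.IH])
qed simp

lemma k_times_differentiable_on_add:
  "k_times_differentiable_on S n f \<Longrightarrow> k_times_differentiable_on S n h \<Longrightarrow>
     k_times_differentiable_on S n (\<lambda>y. f y + h y)"
proof (induction n arbitrary: f h)
  case (Suc n)
  obtain f' where f': "\<And>y. y \<in> S \<Longrightarrow> (f has_real_derivative f' y) (at y within S)"
    "k_times_differentiable_on S n f'"
    using Suc.prems(1) by (rule k_times_differentiable_on_SucE) blast
  obtain h' where h': "\<And>y. y \<in> S \<Longrightarrow> (h has_real_derivative h' y) (at y within S)"
    "k_times_differentiable_on S n h'"
    using Suc.prems(2) by (rule k_times_differentiable_on_SucE) blast
  show ?case
    by (rule k_times_differentiable_on_SucI[OF DERIV_add[OF f'(1) h'(1)] Suc.IH[OF f'(2) h'(2)]])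
qed simp

lemma k_times_differentiable_on_mult:
  "k_times_differentiable_on S n f \<Longrightarrow> k_times_differentiable_on S n h \<Longrightarrow>
     k_times_differentiable_on S n (\<lambda>y. f y * h y)"
proof (induction n arbitrary: f h)
  case (Suc n)
  note fh = Suc.prems[THEN k_times_differentiable_on_Suc_imp]
  obtain f' where f': "\<And>y. y \<in> S \<Longrightarrow> (f has_real_derivative f' y) (at y within S)"
    "k_times_differentiable_on S n f'"
    using Suc.prems(1) by (rule k_times_differentiable_on_SucE) blast
  obtain h' where h': "\<And>y. y \<in> S \<Longrightarrow> (h has_real_derivative h' y) (at y within S)"
    "k_times_differentiable_on S n h'"
    using Suc.prems(2) by (rule k_times_differentiable_on_SucE) blast
  show ?case
    by (rule k_times_differentiable_on_SucI[OF DERIV_mult[OF f'(1) h'(1)]])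
       (auto intro!: k_times_differentiable_on_add Suc.IH fh f'(2) h'(2))
qed simp

lemma k_times_differentiable_on_inverse:
  "k_times_differentiable_on S n f \<Longrightarrow> (\<And>y. y \<in> S \<Longrightarrow> f y \<noteq> 0) \<Longrightarrow>
     k_times_differentiable_on S n (\<lambda>y. inverse (f y))"
proof (induction n)
  case (Suc n)
  have inv: "k_times_differentiable_on S n (\<lambda>y. inverse (f y))"
    using Suc k_times_differentiable_on_Suc_imp by blast
  obtain f' where f': "\<And>y. y \<in> S \<Longrightarrow> (f has_real_derivative f' y) (at y within S)"
    "k_times_differentiable_on S n f'"
    using Suc.prems(1) by (rule k_times_differentiable_on_SucE) blast
  show ?case
  proof (rule k_times_differentiable_on_SucI)
    show "((\<lambda>y. inverse (f y)) has_real_derivative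
        (- 1) * (inverse (f y) * f' y * inverse (f y))) (at y within S)" if "y \<in> S" for y
      using DERIV_inverse'[OF f'(1)[OF that] Suc.prems(2)[OF that]] by simp
    show "k_times_differentiable_on S n (\<lambda>y. (- 1) * (inverse (f y) * f' y * inverse (f y)))"
      by (intro k_times_differentiable_on_mult k_times_differentiable_on_const inv f')
  qed
qed simp

lemma k_times_differentiable_on_uminus:
  assumes "k_times_differentiable_on S n f"
  shows "k_times_differentiable_on S n (\<lambda>y. - f y)"
  using k_times_differentiable_on_mult[OF k_times_differentiable_on_const[of S n "-1"] assms] by simp

lemma k_times_differentiable_on_diff:
  assumes "k_times_differentiable_on S n f" "k_times_differentiable_on S n h"
  shows "k_times_differentiable_on S n (\<lambda>y. f y - h y)"
  using k_times_differentiable_on_add[OF assms(1) k_times_differentiable_on_uminus[OF assms(2)]] by simp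

lemma k_times_differentiable_on_divide:
  assumes "k_times_differentiable_on S n f" "k_times_differentiable_on S n h"
    and "\<And>y. y \<in> S \<Longrightarrow> h y \<noteq> 0"
  shows "k_times_differentiable_on S n (\<lambda>y. f y / h y)"
  using k_times_differentiable_on_mult[OF assms(1) k_times_differentiable_on_inverse[OF assms(2,3)]]
  by (simp add: divide_inverse)

lemmas k_times_differentiable_on_intros =
  k_times_differentiable_on_const k_times_differentiable_on_add k_times_differentiable_on_mult
  k_times_differentiable_on_uminus k_times_differentiable_on_diff k_times_differentiable_on_divide

lemma dy_eq:
  assumes "0 < L" "y \<in> {-L..L}" "(f has_real_derivative D) (at y within {-L..L})"
  shows "dy L f y = D"
  unfolding dy_def
  using vector_derivative_within_cbox[of "-L" L y f D] assms
  by (simp add: has_real_derivative_iff_has_vector_derivative)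

text \<open>On a nondegenerate interval the derivative is determined by the function, so the witnesses
  for different orders agree and iterating \<open>dy\<close> yields one sequence of derivatives.\<close>

lemma smooth_onI:
  assumes L: "0 < L" and diff: "\<And>n. k_times_differentiable_on {-L..L} n f"
  shows "smooth_on {-L..L} f"
proof -
  have step: "(\<forall>y\<in>{-L..L}. (h has_real_derivative dy L h y) (at y within {-L..L})) \<and>
      (\<forall>n. k_times_differentiable_on {-L..L} n (dy L h))"
    if h: "\<And>n. k_times_differentiable_on {-L..L} n h" for h
  proof -
    have "(\<forall>y\<in>{-L..L}. (h has_real_derivative dy L h y) (at y within {-L..L})) \<and>
        k_times_differentiable_on {-L..L} n (dy L h)" for n
    proof -
      obtain h' where h': "\<And>y. y \<in> {-L..L} \<Longrightarrow> (h has_real_derivative h' y) (at y within {-L..L})"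
          "k_times_differentiable_on {-L..L} n h'"
        using h[of "Suc n"] by (rule k_times_differentiable_on_SucE) blast
      moreover have "h' y = dy L h y" if "y \<in> {-L..L}" for y
        using dy_eq[OF L that h'(1)[OF that]] by simp
      ultimately show ?thesis
        using k_times_differentiable_on_cong[OF h'(2)] by auto
    qed
    then show ?thesis by blast
  qed
  have all: "k_times_differentiable_on {-L..L} m ((dy L ^^ n) f)" for n m
    by (induction n arbitrary: m) (use diff step in auto)
  show ?thesis
    unfolding smooth_on_def
    by (rule exI[of _ "\<lambda>n. (dy L ^^ n) f"]) (use step[OF all] in auto)
qed

section \<open>Properties of stationary profiles\<close>

locale stationary_pair =
  fixes L g \<gamma>\<^sub>1 \<gamma>\<^sub>2 :: real and r b :: "real \<Rightarrow> real"
  assumes L: "0 < L" and g: "0 < g" and mobility: "0 < \<gamma>\<^sub>1 + \<gamma>\<^sub>2"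
    and stationary: "stationary_profile L g \<gamma>\<^sub>1 \<gamma>\<^sub>2 r b"
begin

text \<open>With \<open>P = r/(1-\<rho>)\<close> and \<open>Q = b/(1-\<rho>)\<close> the densities are recovered as \<open>r = P/(1+P+Q)\<close>,
  \<open>b = Q/(1+P+Q)\<close>, the constraints \<open>r, b \<ge> 0\<close>, \<open>\<rho> < 1\<close> become \<open>P, Q \<ge> 0\<close>, and the fluxes become linear
  in the derivatives of \<open>P\<close>, \<open>Q\<close> and the interaction term \<open>F\<close>.\<close>

definition c :: real where "c = (\<gamma>\<^sub>1 + \<gamma>\<^sub>2) / 2"
definition P :: "real \<Rightarrow> real" where "P y = r y / (1 - (r y + b y))"
definition Q :: "real \<Rightarrow> real" where "Q y = b y / (1 - (r y + b y))"
definition F :: "real \<Rightarrow> real" where "F y = r y * b y / (1 - (r y + b y))"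
text \<open>The determinant, up to positive factors, of the linear system for \<open>P'\<close> and \<open>Q'\<close>.\<close>

definition N :: "real \<Rightarrow> real" where
  "N y = g * (1 + P y + Q y)\<^sup>2 + c * (P y + Q y + (P y)\<^sup>2 + (Q y)\<^sup>2)"

lemma c_pos: "0 < c"
  using mobility by (simp add: c_def)

lemma density_bounds: "y \<in> {-L..L} \<Longrightarrow> 0 \<le> r y \<and> 0 \<le> b y \<and> r y + b y < 1"
  using stationary by (auto simp: stationary_profile_def Let_def)

lemma PQ_nonneg: "y \<in> {-L..L} \<Longrightarrow> 0 \<le> P y \<and> 0 \<le> Q y"
  using density_bounds[of y] by (simp add: P_def Q_def)

lemma one_plus_eq:
  assumes "y \<in> {-L..L}" shows "1 + P y + Q y = 1 / (1 - (r y + b y))"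
  using density_bounds[OF assms] by (simp add: P_def Q_def field_simps)

lemma r_eq: "y \<in> {-L..L} \<Longrightarrow> r y = P y / (1 + P y + Q y)"
  and b_eq: "y \<in> {-L..L} \<Longrightarrow> b y = Q y / (1 + P y + Q y)"
  and F_eq: "y \<in> {-L..L} \<Longrightarrow> F y = P y * Q y / (1 + P y + Q y)"
  using density_bounds[of y] by (simp_all only: one_plus_eq) (simp_all add: P_def Q_def F_def)

lemma N_pos:
  assumes "y \<in> {-L..L}" shows "0 < N y"
  using PQ_nonneg[OF assms] g c_pos unfolding N_def
  by (intro add_pos_nonneg mult_pos_pos mult_nonneg_nonneg) auto

lemma one_plus_pos: "y \<in> {-L..L} \<Longrightarrow> 0 < 1 + P y + Q y"
  using PQ_nonneg[of y] by auto

text \<open>Solving the two equations for the derivatives turns stationarity into an autonomous system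
  with a rational right-hand side in which each derivative has the factor \<open>F\<close>.\<close>

lemma
  assumes y: "y \<in> {-L..L}"
  shows deriv_P: "(P has_real_derivative
           - F y * (N y + c * (P y - Q y) * (1 + P y + Q y)) / (g * N y)) (at y within {-L..L})" (is ?P)
    and deriv_Q: "(Q has_real_derivative
           F y * (N y - c * (P y - Q y) * (1 + P y + Q y)) / (g * N y)) (at y within {-L..L})" (is ?Q)
    and deriv_F: "(F has_real_derivative
           (P y - Q y) * (1 + P y + Q y) / N y * F y) (at y within {-L..L})" (is ?F)
proof -
  let ?s = "1 + P y + Q y"
  have "r differentiable (at y within {-L..L})" "b differentiable (at y within {-L..L})"
    using stationary y by (auto simp: stationary_profile_def Let_def)
  then have "P differentiable (at y within {-L..L})" "Q differentiable (at y within {-L..L})"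
    unfolding P_def[abs_def] Q_def[abs_def] using density_bounds[OF y]
    by (auto intro!: derivative_intros)
  then obtain p q where p: "(P has_real_derivative p) (at y within {-L..L})"
      and q: "(Q has_real_derivative q) (at y within {-L..L})"
    by (auto simp: real_differentiable_def)
  define f where "f = (p * (Q y * (1 + Q y)) + q * (P y * (1 + P y))) / ?s\<^sup>2"
  have "((\<lambda>y. P y * Q y / (1 + P y + Q y)) has_real_derivative f) (at y within {-L..L})"
    by (rule derivative_eq_intros p q refl)+
       (use one_plus_pos[OF y] in \<open>simp_all add: f_def power2_eq_square field_simps\<close>)
  then have f: "(F has_real_derivative f) (at y within {-L..L})"
    by (rule has_field_derivative_transform_within[OF _ zero_less_one y]) (simp add: F_eq)
  have "0 = F y + c * f + g * p \<and> 0 = - F y + c * f + g * q"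
    using bspec[OF stationary[unfolded stationary_profile_def Let_def] y]
      dy_eq[OF L y f] dy_eq[OF L y p] dy_eq[OF L y q]
    by (simp add: c_def F_def[abs_def] P_def[abs_def] Q_def[abs_def])
  then have gp: "g * p = - F y - c * f" and gq: "g * q = F y - c * f"
    by linarith+
  \<comment> \<open>Expressing \<open>p\<close> and \<open>q\<close> through \<open>f\<close> leaves one linear equation for \<open>f\<close>.\<close>
  have "f * ?s\<^sup>2 = p * (Q y * (1 + Q y)) + q * (P y * (1 + P y))"
    using one_plus_pos[OF y] by (simp add: f_def)
  then have "g * (f * ?s\<^sup>2) = (g * p) * (Q y * (1 + Q y)) + (g * q) * (P y * (1 + P y))"
    by (simp add: algebra_simps)
  then have fN: "f * N y = F y * (P y - Q y) * ?s"
    unfolding gp gq N_def by (simp add: algebra_simps power2_eq_square)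
  then have f_eq: "f = (P y - Q y) * ?s / N y * F y"
    using N_pos[OF y] by (simp add: field_simps)
  have gN: "g * N y \<noteq> 0"
    using N_pos[OF y] g by simp
  have "p * (g * N y) = - F y * N y - c * (f * N y)" "q * (g * N y) = F y * N y - c * (f * N y)"
    using arg_cong[OF gp, of "\<lambda>z. z * N y"] arg_cong[OF gq, of "\<lambda>z. z * N y"]
    by (simp_all add: algebra_simps)
  then have "p * (g * N y) = - F y * (N y + c * (P y - Q y) * ?s)"
      and "q * (g * N y) = F y * (N y - c * (P y - Q y) * ?s)"
    unfolding fN by (simp_all add: algebra_simps)
  then have "p = - F y * (N y + c * (P y - Q y) * ?s) / (g * N y)"
      and "q = F y * (N y - c * (P y - Q y) * ?s) / (g * N y)"
    by (simp_all only: nonzero_eq_divide_eq[OF gN])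
  with p q f f_eq show ?P ?Q ?F
    by simp_all
qed

text \<open>The terms of indefinite sign cancel in the quotient rule:
  \<open>N + c d (1 - d)\<close> and \<open>N - c d (1 + d)\<close> with \<open>d = P - Q\<close> contain \<open>P + Q + P\<^sup>2 + Q\<^sup>2 - d\<^sup>2 \<plusminus> d\<close>, which
  is \<open>2P(1 + Q)\<close> and \<open>2Q(1 + P)\<close> respectively. Hence the sign of \<open>F\<close> alone decides monotonicity.\<close>

lemma
  assumes y: "y \<in> {-L..L}"
  shows deriv_r: "(r has_real_derivative
      - F y * (g * (1 + P y + Q y)\<^sup>2 + 2 * c * P y * (1 + Q y)) / (g * N y * (1 + P y + Q y)))
      (at y within {-L..L})" (is ?r)
    and deriv_b: "(b has_real_derivative
      F y * (g * (1 + P y + Q y)\<^sup>2 + 2 * c * Q y * (1 + P y)) / (g * N y * (1 + P y + Q y)))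
      (at y within {-L..L})" (is ?b)
proof -
  let ?s = "1 + P y + Q y" and ?d = "P y - Q y"
  define p q where "p = - F y * (N y + c * ?d * ?s) / (g * N y)"
    and "q = F y * (N y - c * ?d * ?s) / (g * N y)"
  have pos: "0 < ?s" "0 < g * N y"
    using one_plus_pos[OF y] N_pos[OF y] g by auto
  note pq = deriv_P[OF y, folded p_def] deriv_Q[OF y, folded q_def]
  have N_r: "N y + c * ?d * (1 - ?d) = g * ?s\<^sup>2 + 2 * c * P y * (1 + Q y)"
    and N_b: "N y - c * ?d * (1 + ?d) = g * ?s\<^sup>2 + 2 * c * Q y * (1 + P y)"
    by (simp_all add: N_def power2_eq_square algebra_simps)
  have "p * (1 + Q y) - P y * q = - F y * (?s * (N y + c * ?d * (1 - ?d))) / (g * N y)"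
    unfolding p_def q_def times_divide_eq_left times_divide_eq_right diff_divide_distrib[symmetric]
    by (intro arg_cong2[of _ _ _ _ "(/)"] refl) algebra
  then have r': "(p * (1 + Q y) - P y * q) / (?s * ?s)
      = - F y * (g * ?s\<^sup>2 + 2 * c * P y * (1 + Q y)) / (g * N y * ?s)"
    unfolding N_r using pos by simp
  have "q * (1 + P y) - Q y * p = F y * (?s * (N y - c * ?d * (1 + ?d))) / (g * N y)"
    unfolding p_def q_def times_divide_eq_left times_divide_eq_right diff_divide_distrib[symmetric]
    by (intro arg_cong2[of _ _ _ _ "(/)"] refl) algebra
  then have b': "(q * (1 + P y) - Q y * p) / (?s * ?s)
      = F y * (g * ?s\<^sup>2 + 2 * c * Q y * (1 + P y)) / (g * N y * ?s)"
    unfolding N_b using pos by simp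
  have "((\<lambda>y. P y / (1 + P y + Q y)) has_real_derivative (p * (1 + Q y) - P y * q) / (?s * ?s))
      (at y within {-L..L})"
    by (rule derivative_eq_intros pq refl)+ (use pos in \<open>simp_all add: algebra_simps\<close>)
  then show ?r
    unfolding r'
    by (rule has_field_derivative_transform_within[OF _ zero_less_one y]) (simp add: r_eq)
  have "((\<lambda>y. Q y / (1 + P y + Q y)) has_real_derivative (q * (1 + P y) - Q y * p) / (?s * ?s))
      (at y within {-L..L})"
    by (rule derivative_eq_intros pq refl)+ (use pos in \<open>simp_all add: algebra_simps\<close>)
  then show ?b
    unfolding b'
    by (rule has_field_derivative_transform_within[OF _ zero_less_one y]) (simp add: b_eq)
qed

lemma continuous_r: "continuous_on {-L..L} r" and continuous_b: "continuous_on {-L..L} b"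
  by (auto intro!: DERIV_continuous_on deriv_r deriv_b)

text \<open>Bootstrapping: \<open>P'\<close> and \<open>Q'\<close> are rational functions of \<open>P\<close> and \<open>Q\<close> with nonvanishing
  denominators, so each order of differentiability gives the next one.\<close>

lemma smooth_r: "smooth_on {-L..L} r" and smooth_b: "smooth_on {-L..L} b"
proof -
  note D_intros = k_times_differentiable_on_intros
  have PQ: "k_times_differentiable_on {-L..L} n P \<and> k_times_differentiable_on {-L..L} n Q" for n
  proof (induction n)
    case (Suc n)
    then have IH: "k_times_differentiable_on {-L..L} n P" "k_times_differentiable_on {-L..L} n Q"
      by auto
    have N: "k_times_differentiable_on {-L..L} n N"
      unfolding N_def[abs_def] power2_eq_square by (intro D_intros IH)
    have "k_times_differentiable_on {-L..L} n (\<lambda>y. P y * Q y / (1 + P y + Q y))"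
      using one_plus_pos by (intro D_intros IH) force
    then have F: "k_times_differentiable_on {-L..L} n F"
      by (rule k_times_differentiable_on_cong) (simp add: F_eq)
    have nz: "g * N y \<noteq> 0" if "y \<in> {-L..L}" for y
      using N_pos[OF that] g by simp
    show ?case
      by (intro conjI k_times_differentiable_on_SucI[OF deriv_P]
            k_times_differentiable_on_SucI[OF deriv_Q]; assumption?)
         (intro D_intros IH N F nz; assumption)+
  qed simp
  have nz: "1 + P y + Q y \<noteq> 0" if "y \<in> {-L..L}" for y
    using one_plus_pos[OF that] by simp
  have "k_times_differentiable_on {-L..L} n (\<lambda>y. P y / (1 + P y + Q y))" for n
    using PQ[of n] by (intro D_intros nz) simp_all
  then have "k_times_differentiable_on {-L..L} n r" for n
    by (rule k_times_differentiable_on_cong) (simp add: r_eq)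
  then show "smooth_on {-L..L} r"
    by (rule smooth_onI[OF L])
  have "k_times_differentiable_on {-L..L} n (\<lambda>y. Q y / (1 + P y + Q y))" for n
    using PQ[of n] by (intro D_intros nz) simp_all
  then have "k_times_differentiable_on {-L..L} n b" for n
    by (rule k_times_differentiable_on_cong) (simp add: b_eq)
  then show "smooth_on {-L..L} b"
    by (rule smooth_onI[OF L])
qed

text \<open>\<open>F\<close> solves a homogeneous linear equation \<open>F' = h F\<close>, so \<open>F = const \<cdot> exp (\<integral>h)\<close>.\<close>

lemma interaction_zero_propagates:
  assumes y0: "y0 \<in> {-L..L}" "F y0 = 0" and y: "y \<in> {-L..L}"
  shows "F y = 0"
proof -
  let ?h = "\<lambda>y. (P y - Q y) * (1 + P y + Q y) / N y"
  have "continuous_on {-L..L} P" "continuous_on {-L..L} Q"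
    by (auto intro!: DERIV_continuous_on deriv_P deriv_Q)
  then have "continuous_on {-L..L} ?h"
    using N_pos unfolding N_def by (intro continuous_intros ballI) fastforce+
  then obtain A where A: "\<And>y. y \<in> {-L..L} \<Longrightarrow> (A has_real_derivative ?h y) (at y within {-L..L})"
    using antiderivative_continuous[of "-L" L ?h]
    by (auto simp: has_real_derivative_iff_has_vector_derivative)
  have "((\<lambda>y. F y * exp (- A y)) has_real_derivative 0) (at y within {-L..L})"
    if "y \<in> {-L..L}" for y
    by (rule derivative_eq_intros A deriv_F that refl)+ (simp add: algebra_simps)
  then obtain k where "\<And>y. y \<in> {-L..L} \<Longrightarrow> F y * exp (- A y) = k"
    using has_field_derivative_zero_constant[of "{-L..L}" "\<lambda>y. F y * exp (- A y)"] by auto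
  then have "F y * exp (- A y) = F y0 * exp (- A y0)"
    using y y0 by metis
  then show ?thesis using y0 by simp
qed

lemma interaction_zero_imp_one_group_absent:
  assumes y0: "y0 \<in> {-L..L}" "F y0 = 0"
  shows "(\<forall>y\<in>{-L..L}. r y = 0) \<or> (\<forall>y\<in>{-L..L}. b y = 0)"
proof -
  have F0: "F y = 0" if "y \<in> {-L..L}" for y
    using interaction_zero_propagates[OF y0 that] .
  have "(P has_real_derivative 0) (at y within {-L..L})"
    "(Q has_real_derivative 0) (at y within {-L..L})" if "y \<in> {-L..L}" for y
    using deriv_P[OF that] deriv_Q[OF that] F0[OF that] by auto
  then obtain k l where k: "\<And>y. y \<in> {-L..L} \<Longrightarrow> P y = k" and l: "\<And>y. y \<in> {-L..L} \<Longrightarrow> Q y = l"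
    using has_field_derivative_zero_constant[of "{-L..L}" P]
      has_field_derivative_zero_constant[of "{-L..L}" Q] by auto
  have "k = 0 \<or> l = 0"
    using F_eq[OF y0(1)] y0(2) one_plus_pos[OF y0(1)] k[OF y0(1)] l[OF y0(1)] by auto
  then show ?thesis
    using k l r_eq b_eq by auto
qed

lemma interaction_pos:
  assumes "integral {-L..L} r \<noteq> 0" "integral {-L..L} b \<noteq> 0" and y: "y \<in> {-L..L}"
  shows "0 < F y"
proof -
  have "F y \<noteq> 0"
    using interaction_zero_imp_one_group_absent[OF y] assms(1,2)
      integral_cong[of "{-L..L}" r "\<lambda>y. 0"] integral_cong[of "{-L..L}" b "\<lambda>y. 0"] by auto
  moreover have "0 \<le> F y"
    using density_bounds[OF y] by (simp add: F_def)
  ultimately show ?thesis by simp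
qed

lemma densities_monotone:
  assumes "integral {-L..L} r \<noteq> 0" "integral {-L..L} b \<noteq> 0" and y: "y \<in> {-L..L}"
  shows "dy L r y < 0 \<and> dy L b y > 0"
proof -
  have "0 < g * (1 + P y + Q y)\<^sup>2 + 2 * c * P y * (1 + Q y)"
    "0 < g * (1 + P y + Q y)\<^sup>2 + 2 * c * Q y * (1 + P y)"
    using g c_pos PQ_nonneg[OF y] one_plus_pos[OF y] by (auto intro!: add_pos_nonneg)
  moreover have "0 < g * N y * (1 + P y + Q y)"
    using g N_pos[OF y] one_plus_pos[OF y] by simp
  ultimately show ?thesis
    unfolding dy_eq[OF L y deriv_r[OF y]] dy_eq[OF L y deriv_b[OF y]]
    using interaction_pos[OF assms] by (simp add: divide_less_0_iff zero_less_mult_iff)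
qed

text \<open>Rolle's theorem for \<open>z \<mapsto> \<integral>\<^bsub>-L\<^esub>\<^bsup>z\<^esup> (r - b)\<close>, which vanishes at both walls because the masses
  agree, places the crossing in the open interval.\<close>

lemma densities_cross:
  assumes eq: "integral {-L..L} r = integral {-L..L} b"
  shows "\<exists>y\<in>{-L<..<L}. r y = b y"
proof -
  let ?H = "\<lambda>z. integral {-L..z} (\<lambda>y. r y - b y)"
  have cont: "continuous_on {-L..L} (\<lambda>y. r y - b y)"
    by (intro continuous_intros continuous_r continuous_b)
  have H: "(?H has_real_derivative r y - b y) (at y within {-L..L})" if "y \<in> {-L..L}" for y
    by (rule integral_has_real_derivative[OF cont that])
  have "\<exists>z>-L. z < L \<and> (\<lambda>h. (r z - b z) * h) = (\<lambda>h. 0)"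
  proof (rule Rolle_deriv)
    show "?H (-L) = ?H L"
      using eq by (simp add: integral_diff integrable_continuous_real continuous_r continuous_b)
    show "continuous_on {-L..L} ?H"
      by (rule DERIV_continuous_on[OF H])
    fix y assume y: "-L < y" "y < L"
    have "(?H has_real_derivative r y - b y) (at y)"
      using H[of y] y at_within_Icc_at[of "-L" y L] by simp
    then show "(?H has_derivative (\<lambda>h. (r y - b y) * h)) (at y)"
      by (simp add: has_field_derivative_def)
  qed (use L in auto)
  then obtain z where z: "-L < z" "z < L" "(\<lambda>h. (r z - b z) * h) = (\<lambda>h. 0)" by blast
  then show "\<exists>y\<in>{-L<..<L}. r y = b y"
    using fun_cong[OF z(3), of 1, simplified] by (intro bexI[of _ z]) auto
qed

end

section \<open>Construction of stationary profiles with prescribed mass\<close>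

locale stationary_family =
  fixes g c :: real
  assumes g: "0 < g" and c: "0 < c"
begin

text \<open>In the variables \<open>s = P + Q\<close> and \<open>d = P - Q\<close> the sum of the two equations says that
  \<open>2cF + g s\<close> is constant, where \<open>4F = (s\<^sup>2 - d\<^sup>2)/(1 + s)\<close>. On the level set with value \<open>g \<kappa>\<close>, and
  with \<open>d = \<kappa> v\<close>, this is a quadratic equation for \<open>s\<close>, and \<open>S \<kappa> v\<close> is its positive root. The
  parameter \<open>\<kappa>\<close> is the value of \<open>s\<close> and of \<open>\<bar>d\<bar>\<close> at the equilibria on that level set.\<close>

definition S :: "real \<Rightarrow> real \<Rightarrow> real" where
  "S \<kappa> v = (g * (\<kappa> - 1) + sqrt ((g * (\<kappa> - 1))\<^sup>2 + (c + 2 * g) * (c * \<kappa>\<^sup>2 * v\<^sup>2 + 2 * g * \<kappa>)))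
            / (c + 2 * g)"

text \<open>What remains of the system is \<open>d' = - (\<kappa> - S)/c\<close>, with equilibria at \<open>v = \<plusminus>1\<close>. Putting
  \<open>v = - tanh \<theta>\<close> moves them to infinity and leaves \<open>\<theta>' = 1/\<Lambda>\<close>; the sign of \<open>\<theta>\<close> does not affect
  \<open>\<Lambda>\<close>, since \<open>S \<kappa>\<close> is even.\<close>

definition \<Lambda> :: "real \<Rightarrow> real \<Rightarrow> real" where
  "\<Lambda> \<kappa> x = (c * (\<kappa> + S \<kappa> (tanh x)) + 2 * g * (1 + S \<kappa> (tanh x))) / \<kappa>"

lemma radicand_gt:
  assumes "0 < \<kappa>"
  shows "(g * (\<kappa> - 1))\<^sup>2 < (g * (\<kappa> - 1))\<^sup>2 + (c + 2 * g) * (c * \<kappa>\<^sup>2 * v\<^sup>2 + 2 * g * \<kappa>)"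
  using g c assms by (simp add: add_nonneg_pos)

lemma S_pos:
  assumes "0 < \<kappa>" shows "0 < S \<kappa> v"
proof -
  have "\<bar>g * (\<kappa> - 1)\<bar> < sqrt ((g * (\<kappa> - 1))\<^sup>2 + (c + 2 * g) * (c * \<kappa>\<^sup>2 * v\<^sup>2 + 2 * g * \<kappa>))"
    using real_sqrt_less_mono[OF radicand_gt[OF assms]] by simp
  then have "0 < g * (\<kappa> - 1) + sqrt ((g * (\<kappa> - 1))\<^sup>2 + (c + 2 * g) * (c * \<kappa>\<^sup>2 * v\<^sup>2 + 2 * g * \<kappa>))"
    by linarith
  then show ?thesis
    using g c by (simp add: S_def)
qed

text \<open>The quadratic equation solved by \<open>S\<close>, in the form \<open>4 c (1 + s) F = 2 g (1 + s) (\<kappa> - s)\<close>.\<close>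

lemma first_integral:
  assumes "0 < \<kappa>"
  shows "c * ((S \<kappa> v)\<^sup>2 - (\<kappa> * v)\<^sup>2) = 2 * g * (1 + S \<kappa> v) * (\<kappa> - S \<kappa> v)"
proof -
  define A where "A = c + 2 * g"
  define s where "s = S \<kappa> v"
  have A: "0 < A" using g c by (simp add: A_def)
  have "A * s - g * (\<kappa> - 1) = sqrt ((g * (\<kappa> - 1))\<^sup>2 + A * (c * \<kappa>\<^sup>2 * v\<^sup>2 + 2 * g * \<kappa>))"
    using A by (simp add: s_def S_def A_def[symmetric])
  then have "(A * s - g * (\<kappa> - 1))\<^sup>2 = (g * (\<kappa> - 1))\<^sup>2 + A * (c * \<kappa>\<^sup>2 * v\<^sup>2 + 2 * g * \<kappa>)"
    using radicand_gt[OF assms, of v] by (simp add: A_def power2_eq_square)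
  then have "A * (A * s\<^sup>2 - 2 * g * (\<kappa> - 1) * s) = A * (c * \<kappa>\<^sup>2 * v\<^sup>2 + 2 * g * \<kappa>)"
    by (simp add: power2_eq_square algebra_simps)
  then have "A * s\<^sup>2 - 2 * g * (\<kappa> - 1) * s = c * \<kappa>\<^sup>2 * v\<^sup>2 + 2 * g * \<kappa>"
    using A by (simp only: mult_cancel_left) auto
  then show ?thesis
    unfolding s_def[symmetric] A_def by (simp add: power2_eq_square algebra_simps)
qed

text \<open>Both bounds come from the signs in the first integral: its left-hand side would be positive and
  its right-hand side negative if \<open>S\<close> exceeded \<open>\<kappa>\<close>. They express \<open>F \<ge> 0\<close> and \<open>P, Q \<ge> 0\<close>.\<close>

lemma
  assumes "0 < \<kappa>" and v: "\<bar>v\<bar> \<le> 1"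
  shows S_le: "S \<kappa> v \<le> \<kappa>" and S_ge: "\<bar>\<kappa> * v\<bar> \<le> S \<kappa> v"
proof -
  let ?s = "S \<kappa> v"
  have s: "0 < ?s" by (rule S_pos[OF assms(1)])
  have \<kappa>v: "\<bar>\<kappa> * v\<bar> \<le> \<kappa>"
    using assms by (simp add: abs_mult)
  have fi: "c * (?s\<^sup>2 - (\<kappa> * v)\<^sup>2) = 2 * g * (1 + ?s) * (\<kappa> - ?s)"
    by (rule first_integral[OF assms(1)])
  show "?s \<le> \<kappa>"
  proof (rule ccontr)
    assume "\<not> ?s \<le> \<kappa>"
    then have "\<bar>\<kappa> * v\<bar> < \<bar>?s\<bar>" and "2 * g * (1 + ?s) * (\<kappa> - ?s) < 0"
      using \<kappa>v s g by (auto simp: mult_pos_neg)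
    moreover have "0 < c * (?s\<^sup>2 - (\<kappa> * v)\<^sup>2)"
      using \<open>\<bar>\<kappa> * v\<bar> < \<bar>?s\<bar>\<close> c by (simp add: power2_strict_mono)
    ultimately show False using fi by simp
  qed
  then have "0 \<le> c * (?s\<^sup>2 - (\<kappa> * v)\<^sup>2)"
    unfolding fi using g s by simp
  then have "(\<kappa> * v)\<^sup>2 \<le> ?s\<^sup>2"
    using c by (simp add: zero_le_mult_iff)
  then show "\<bar>\<kappa> * v\<bar> \<le> ?s"
    using s by (simp add: abs_le_square_iff[symmetric])
qed

lemma S_ge_linear:
  assumes "1 \<le> \<kappa>" shows "2 * g * (\<kappa> - 1) / (c + 2 * g) \<le> S \<kappa> v"
proof -
  have "sqrt ((g * (\<kappa> - 1))\<^sup>2) \<le> sqrt ((g * (\<kappa> - 1))\<^sup>2 + (c + 2 * g) * (c * \<kappa>\<^sup>2 * v\<^sup>2 + 2 * g * \<kappa>))"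
    using radicand_gt[of \<kappa> v] assms by (intro real_sqrt_le_mono) auto
  then show ?thesis
    unfolding S_def using assms g c by (intro divide_right_mono) auto
qed

lemma continuous_S:
  assumes "continuous_on A f" "continuous_on A h"
  shows "continuous_on A (\<lambda>z. S (f z) (h z))"
  unfolding S_def using g c by (intro continuous_intros assms ballI) auto

lemma S_has_derivative:
  assumes "0 < \<kappa>" shows "\<exists>D. (S \<kappa> has_real_derivative D) (at v)"
proof -
  let ?R = "\<lambda>v. (g * (\<kappa> - 1))\<^sup>2 + (c + 2 * g) * (c * \<kappa>\<^sup>2 * v\<^sup>2 + 2 * g * \<kappa>)"
  have R': "(?R has_real_derivative (c + 2 * g) * (c * \<kappa>\<^sup>2 * (2 * v))) (at v)"
    by (auto intro!: derivative_eq_intros)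
  have pos: "0 < ?R v"
    using radicand_gt[OF assms] by (rule le_less_trans[rotated]) simp
  show ?thesis
    unfolding S_def[abs_def]
    by (rule exI, rule DERIV_cdivide, rule DERIV_add[OF DERIV_const])
       (rule DERIV_chain2[where f = sqrt, OF DERIV_real_sqrt[OF pos] R'])
qed

lemma \<Lambda>_ge:
  assumes "0 < \<kappa>" shows "c \<le> \<Lambda> \<kappa> x"
proof -
  have "c * \<kappa> \<le> c * (\<kappa> + S \<kappa> (tanh x)) + 2 * g * (1 + S \<kappa> (tanh x))"
    using S_pos[OF assms, of "tanh x"] g c by (simp add: distrib_left)
  then show ?thesis
    using assms by (simp add: \<Lambda>_def pos_le_divide_eq)
qed

text \<open>The factor \<open>1 - v\<^sup>2\<close> divides \<open>\<kappa> - S\<close>: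
  \<open>c\<kappa>\<^sup>2(1 - v\<^sup>2) = c(\<kappa>\<^sup>2 - S\<^sup>2) + c(S\<^sup>2 - \<kappa>\<^sup>2v\<^sup>2)\<close>, where the first integral makes \<open>\<kappa> - S\<close> a common factor on
  the right. So \<open>\<theta>' = 1/\<Lambda>\<close> gives \<open>d' = - (\<kappa> - S)/c\<close>.\<close>

lemma \<Lambda>_separates:
  assumes "0 < \<kappa>"
  shows "\<kappa> * (1 - (tanh x)\<^sup>2) / \<Lambda> \<kappa> x = (\<kappa> - S \<kappa> (tanh x)) / c"
proof -
  define s where "s = S \<kappa> (tanh x)"
  define v where "v = tanh x"
  have "c * \<kappa>\<^sup>2 * (1 - v\<^sup>2) = c * (\<kappa>\<^sup>2 - s\<^sup>2) + c * (s\<^sup>2 - (\<kappa> * v)\<^sup>2)"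
    by (simp add: algebra_simps)
  also have "\<dots> = (\<kappa> - s) * (c * (\<kappa> + s) + 2 * g * (1 + s))"
    unfolding s_def v_def first_integral[OF assms] by (simp add: algebra_simps power2_eq_square)
  also have "\<dots> = (\<kappa> - s) * (\<kappa> * \<Lambda> \<kappa> x)"
    using assms by (simp add: \<Lambda>_def s_def)
  finally have "\<kappa> * (c * (\<kappa> * (1 - v\<^sup>2))) = \<kappa> * ((\<kappa> - s) * \<Lambda> \<kappa> x)"
    by (simp add: power2_eq_square algebra_simps)
  then have "c * (\<kappa> * (1 - v\<^sup>2)) = (\<kappa> - s) * \<Lambda> \<kappa> x"
    using assms by simp
  then show ?thesis
    using c \<Lambda>_ge[OF assms, of x] by (simp add: s_def v_def frac_eq_eq mult.commute)
qed

end

text \<open>A one-parameter family of stationary profiles, antisymmetric in the sense \<open>r(-y) = b(y)\<close> and hence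
  with equal masses, is indexed by \<open>\<kappa> > 0\<close>. Since \<open>\<rho> = s/(1 + s)\<close>, the total mass tends to \<open>0\<close> with
  \<open>\<kappa>\<close> because \<open>s \<le> \<kappa>\<close>, and to the length of the interval as \<open>\<kappa> \<rightarrow> \<infinity>\<close> because \<open>s\<close> grows linearly; the
  intermediate value theorem finds the prescribed mass.\<close>

lemma stationary_profile_with_mass:
  fixes L g \<gamma>\<^sub>1 \<gamma>\<^sub>2 m :: real
  assumes L: "0 < L" and g: "0 < g" and mobility: "0 < \<gamma>\<^sub>1 + \<gamma>\<^sub>2" and m: "0 < m" "m < L"
  obtains r b where "stationary_profile L g \<gamma>\<^sub>1 \<gamma>\<^sub>2 r b"
    and "integral {-L..L} r = m" and "integral {-L..L} b = m"
proof -
  define c where "c = (\<gamma>\<^sub>1 + \<gamma>\<^sub>2) / 2"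
  interpret stationary_family g c
    using g mobility by unfold_locales (auto simp: c_def)
  have "continuous_on ({0<..} \<times> UNIV) (\<lambda>(\<kappa>, x). \<Lambda> \<kappa> x)"
    unfolding \<Lambda>_def case_prod_unfold
    by (intro continuous_intros continuous_S) (auto simp: cosh_real_nonzero)
  from separable_ode_with_parameter[OF this c] obtain \<Theta> where
      cont_\<Theta>: "continuous_on ({0<..} \<times> UNIV) (\<lambda>(\<kappa>, y). \<Theta> \<kappa> y)"
    and deriv_\<Theta>: "\<And>\<kappa> y. 0 < \<kappa> \<Longrightarrow> (\<Theta> \<kappa> has_real_derivative 1 / \<Lambda> \<kappa> (\<Theta> \<kappa> y)) (at y)"
    and odd_\<Theta>: "\<And>\<kappa> y. 0 < \<kappa> \<Longrightarrow> \<Theta> \<kappa> (- y) = - \<Theta> \<kappa> y"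
    using \<Lambda>_ge by (auto simp: \<Lambda>_def S_def)
  define s d where "s \<kappa> y = S \<kappa> (tanh (\<Theta> \<kappa> y))" and "d \<kappa> y = - (\<kappa> * tanh (\<Theta> \<kappa> y))" for \<kappa> y
  define r b where "r \<kappa> y = (s \<kappa> y + d \<kappa> y) / 2 / (1 + s \<kappa> y)"
    and "b \<kappa> y = (s \<kappa> y - d \<kappa> y) / 2 / (1 + s \<kappa> y)" for \<kappa> y
  have abs_tanh: "\<bar>tanh x\<bar> \<le> 1" for x :: real
    using tanh_real_bounds[of x] by auto
  have s_pos: "0 < s \<kappa> y" and s_le: "s \<kappa> y \<le> \<kappa>" and d_le: "\<bar>d \<kappa> y\<bar> \<le> s \<kappa> y" if "0 < \<kappa>" for \<kappa> y
    using that S_pos S_le[OF that abs_tanh] S_ge[OF that abs_tanh] by (auto simp: s_def d_def)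
  have total: "r \<kappa> y + b \<kappa> y = s \<kappa> y / (1 + s \<kappa> y)" for \<kappa> y
    unfolding r_def b_def add_divide_distrib[symmetric]
    by (rule arg_cong[where f = "\<lambda>z. z / (1 + s \<kappa> y)"]) simp
  have deriv_d: "(d \<kappa> has_real_derivative - ((\<kappa> - s \<kappa> y) / c)) (at y)" if \<kappa>: "0 < \<kappa>" for \<kappa> y
  proof -
    have "(d \<kappa> has_real_derivative - (\<kappa> * (1 - (tanh (\<Theta> \<kappa> y))\<^sup>2) / \<Lambda> \<kappa> (\<Theta> \<kappa> y))) (at y)"
      unfolding d_def[abs_def] by (auto intro!: derivative_eq_intros deriv_\<Theta>[OF \<kappa>])
    then show ?thesis
      by (simp only: \<Lambda>_separates[OF \<kappa>] s_def)
  qed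
  have stat: "stationary_profile L g \<gamma>\<^sub>1 \<gamma>\<^sub>2 (r \<kappa>) (b \<kappa>)" if \<kappa>: "0 < \<kappa>" for \<kappa>
    unfolding stationary_profile_def Let_def
  proof
    fix y assume y: "y \<in> {-L..L}"
    note pos = s_pos[OF \<kappa>]
    have w: "1 - (r \<kappa> t + b \<kappa> t) = 1 / (1 + s \<kappa> t)" for t
      unfolding total using pos[of t] by (simp add: field_simps)
    have divide_cancels: "x / 2 / a / (1 / a) = x / 2"
      "x / 2 / a * (z / 2 / a) / (1 / a) = x * z / (4 * a)" if "a \<noteq> 0" for a x z :: real
      using that by (simp_all add: field_simps)
    have P: "r \<kappa> t / (1 - (r \<kappa> t + b \<kappa> t)) = (s \<kappa> t + d \<kappa> t) / 2"
      for t
      unfolding w unfolding r_def by (rule divide_cancels(1)) (use pos[of t] in simp)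
    have Q: "b \<kappa> t / (1 - (r \<kappa> t + b \<kappa> t)) = (s \<kappa> t - d \<kappa> t) / 2" for t
      unfolding w unfolding b_def by (rule divide_cancels(1)) (use pos[of t] in simp)
    \<comment> \<open>The first integral turns the interaction term into an affine function of \<open>s\<close>, so that its
      derivative is that of \<open>s\<close> up to a constant and both flux equations reduce to the one for \<open>d\<close>.\<close>
    have F: "r \<kappa> t * b \<kappa> t / (1 - (r \<kappa> t + b \<kappa> t)) = g * (\<kappa> - s \<kappa> t) / (2 * c)" for t
    proof -
      have "c * ((s \<kappa> t)\<^sup>2 - (d \<kappa> t)\<^sup>2) = 2 * g * (1 + s \<kappa> t) * (\<kappa> - s \<kappa> t)"
        using first_integral[OF \<kappa>] by (simp add: s_def d_def)
      then have "((s \<kappa> t)\<^sup>2 - (d \<kappa> t)\<^sup>2) / (4 * (1 + s \<kappa> t)) = g * (\<kappa> - s \<kappa> t) / (2 * c)"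
        using pos[of t] c by (simp add: frac_eq_eq algebra_simps)
      moreover have "r \<kappa> t * b \<kappa> t / (1 - (r \<kappa> t + b \<kappa> t))
          = ((s \<kappa> t)\<^sup>2 - (d \<kappa> t)\<^sup>2) / (4 * (1 + s \<kappa> t))"
        unfolding w unfolding r_def b_def power2_eq_square square_diff_square_factored
        by (rule divide_cancels(2)) (use pos[of t] in simp)
      ultimately show ?thesis by simp
    qed
    obtain D where S': "(S \<kappa> has_real_derivative D) (at (tanh (\<Theta> \<kappa> y)))"
      using S_has_derivative[OF \<kappa>] by blast
    have v': "((\<lambda>y. tanh (\<Theta> \<kappa> y)) has_real_derivative
        (1 - (tanh (\<Theta> \<kappa> y))\<^sup>2) / \<Lambda> \<kappa> (\<Theta> \<kappa> y)) (at y)"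
      by (auto intro!: derivative_eq_intros deriv_\<Theta>[OF \<kappa>])
    define s' where "s' = D * ((1 - (tanh (\<Theta> \<kappa> y))\<^sup>2) / \<Lambda> \<kappa> (\<Theta> \<kappa> y))"
    have s': "((\<lambda>y. s \<kappa> y) has_real_derivative s') (at y within {-L..L})"
      unfolding s_def s'_def by (rule has_field_derivative_at_within[OF DERIV_chain2[OF S' v']])
    define d' where "d' = - ((\<kappa> - s \<kappa> y) / c)"
    have d': "(d \<kappa> has_real_derivative d') (at y within {-L..L})"
      unfolding d'_def by (rule has_field_derivative_at_within[OF deriv_d[OF \<kappa>]])
    have diff: "s \<kappa> differentiable (at y within {-L..L})" "d \<kappa> differentiable (at y within {-L..L})"
      using s' d' by (auto simp: real_differentiable_def)
    have dF: "dy L (\<lambda>t. g * (\<kappa> - s \<kappa> t) / (2 * c)) y = g * (- s') / (2 * c)"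
      by (rule dy_eq[OF L y]) (use c in \<open>auto intro!: derivative_eq_intros s'\<close>)
    have dP: "dy L (\<lambda>t. (s \<kappa> t + d \<kappa> t) / 2) y = (s' + d') / 2"
      by (rule dy_eq[OF L y]) (auto intro!: derivative_eq_intros s' d')
    have dQ: "dy L (\<lambda>t. (s \<kappa> t - d \<kappa> t) / 2) y = (s' - d') / 2"
      by (rule dy_eq[OF L y]) (auto intro!: derivative_eq_intros s' d')
    have "r \<kappa> differentiable (at y within {-L..L})"
        "b \<kappa> differentiable (at y within {-L..L})"
      unfolding r_def[abs_def] b_def[abs_def] using diff pos[of y]
      by (auto intro!: derivative_intros)
    moreover have "0 \<le> r \<kappa> y" "0 \<le> b \<kappa> y" "r \<kappa> y + b \<kappa> y < 1"
      using d_le[OF \<kappa>, of y] pos[of y] by (auto simp: total) (auto simp: r_def b_def)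
    ultimately show "0 \<le> r \<kappa> y \<and> 0 \<le> b \<kappa> y \<and> r \<kappa> y + b \<kappa> y < 1 \<and>
        r \<kappa> differentiable (at y within {-L..L}) \<and> b \<kappa> differentiable (at y within {-L..L}) \<and>
        0 = r \<kappa> y * b \<kappa> y / (1 - (r \<kappa> y + b \<kappa> y))
            + (\<gamma>\<^sub>1 + \<gamma>\<^sub>2) / 2 * dy L (\<lambda>t. r \<kappa> t * b \<kappa> t / (1 - (r \<kappa> t + b \<kappa> t))) y
            + g * dy L (\<lambda>t. r \<kappa> t / (1 - (r \<kappa> t + b \<kappa> t))) y \<and>
        0 = - (r \<kappa> y * b \<kappa> y / (1 - (r \<kappa> y + b \<kappa> y)))
            + (\<gamma>\<^sub>1 + \<gamma>\<^sub>2) / 2 * dy L (\<lambda>t. r \<kappa> t * b \<kappa> t / (1 - (r \<kappa> t + b \<kappa> t))) y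
            + g * dy L (\<lambda>t. b \<kappa> t / (1 - (r \<kappa> t + b \<kappa> t))) y"
      unfolding P Q F c_def[symmetric] dF dP dQ using c by (simp add: d'_def field_simps)
  qed
  have pair: "stationary_pair L g \<gamma>\<^sub>1 \<gamma>\<^sub>2 (r \<kappa>) (b \<kappa>)" if "0 < \<kappa>" for \<kappa>
    using L g mobility stat[OF that] by unfold_locales
  define total_mass where "total_mass \<kappa> = integral {-L..L} (\<lambda>y. s \<kappa> y / (1 + s \<kappa> y))" for \<kappa>
  have half: "integral {-L..L} (r \<kappa>) = total_mass \<kappa> / 2 \<and> integral {-L..L} (b \<kappa>) = total_mass \<kappa> / 2"
    if \<kappa>: "0 < \<kappa>" for \<kappa>
  proof -
    interpret stationary_pair L g \<gamma>\<^sub>1 \<gamma>\<^sub>2 "r \<kappa>" "b \<kappa>" by (rule pair[OF \<kappa>])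
    have "r \<kappa> (- y) = b \<kappa> y" for y
      by (simp add: r_def b_def s_def d_def odd_\<Theta>[OF \<kappa>] S_def)
    then have "integral {-L..L} (r \<kappa>) = integral {-L..L} (b \<kappa>)"
      using Henstock_Kurzweil_Integration.integral_reflect_real[of L "- L" "r \<kappa>"] by simp
    moreover have "integral {-L..L} (r \<kappa>) + integral {-L..L} (b \<kappa>) = total_mass \<kappa>"
      unfolding total_mass_def total[symmetric]
      by (rule integral_add[symmetric])
         (auto intro!: integrable_continuous_real continuous_r continuous_b)
    ultimately show ?thesis by simp
  qed
  have cont_s: "continuous_on ({0<..} \<times> UNIV) (\<lambda>z. s (fst z) (snd z))"
    unfolding s_def using cont_\<Theta>
    by (intro continuous_S continuous_intros) (auto simp: case_prod_unfold cosh_real_nonzero)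
  have integrand: "continuous_on ({0<..} \<times> cbox (-L) L) (\<lambda>(\<kappa>, y). s \<kappa> y / (1 + s \<kappa> y))"
  proof -
    have "1 + s (fst z) (snd z) \<noteq> 0" if "z \<in> {0<..} \<times> cbox (-L) L" for z
      using s_pos[of "fst z" "snd z"] that by auto
    then show ?thesis
      unfolding case_prod_unfold
      by (intro continuous_intros continuous_on_subset[OF cont_s] ballI) auto
  qed
  have cont_mass: "continuous_on {0<..} total_mass"
    using integral_continuous_on_param[OF integrand] by (simp add: total_mass_def[abs_def])
  have integrable: "(\<lambda>y. s \<kappa> y / (1 + s \<kappa> y)) integrable_on {-L..L}" if "0 < \<kappa>" for \<kappa>
    using continuous_on_compose2[OF integrand, of "{-L..L}" "\<lambda>y. (\<kappa>, y)"] that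
    by (intro integrable_continuous_real) (auto simp: continuous_on_Pair image_subset_iff)
  \<comment> \<open>\<open>\<kappa>0\<close> makes \<open>\<rho> \<le> m/L\<close> everywhere, and \<open>\<kappa>1\<close> solves \<open>2g(\<kappa> - 1)/(c + 2g) = m/(L - m)\<close>, which
    makes \<open>\<rho> \<ge> m/L\<close> everywhere.\<close>
  define \<kappa>0 where "\<kappa>0 = min 1 (m / L)"
  define \<kappa>1 where "\<kappa>1 = 1 + (c + 2 * g) / (2 * g) * (m / (L - m))"
  have \<kappa>: "0 < \<kappa>0" "\<kappa>0 \<le> 1" "1 \<le> \<kappa>1"
    using m L g c by (auto simp: \<kappa>0_def \<kappa>1_def)
  have "total_mass \<kappa>0 \<le> integral {-L..L} (\<lambda>y. m / L)"
    unfolding total_mass_def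
  proof (rule integral_le)
    fix y
    have "s \<kappa>0 y / (1 + s \<kappa>0 y) \<le> s \<kappa>0 y"
      using s_pos[OF \<kappa>(1), of y] by (simp add: divide_le_eq)
    also have "\<dots> \<le> m / L"
      using s_le[OF \<kappa>(1), of y] by (simp add: \<kappa>0_def)
    finally show "s \<kappa>0 y / (1 + s \<kappa>0 y) \<le> m / L" .
  qed (use integrable \<kappa> in auto)
  then have small: "total_mass \<kappa>0 \<le> 2 * m"
    using L by simp
  have "integral {-L..L} (\<lambda>y. m / L) \<le> total_mass \<kappa>1"
    unfolding total_mass_def
  proof (rule integral_le)
    fix y
    have "m / (L - m) \<le> s \<kappa>1 y"
      using S_ge_linear[OF \<kappa>(3), of "tanh (\<Theta> \<kappa>1 y)"] g c by (simp add: s_def \<kappa>1_def)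
    then show "m / L \<le> s \<kappa>1 y / (1 + s \<kappa>1 y)"
      using m L s_pos[of \<kappa>1 y] \<kappa> by (simp add: field_simps)
  qed (use integrable \<kappa> in auto)
  then have large: "2 * m \<le> total_mass \<kappa>1"
    using L by simp
  have "\<exists>\<kappa>\<ge>\<kappa>0. \<kappa> \<le> \<kappa>1 \<and> total_mass \<kappa> = 2 * m"
    using \<kappa> by (intro IVT' small large continuous_on_subset[OF cont_mass]) auto
  then obtain \<kappa> where "0 < \<kappa>" "total_mass \<kappa> = 2 * m"
    using \<kappa>(1) by (meson less_le_trans)
  with stat[of \<kappa>] half[of \<kappa>] show thesis
    by (intro that[of "r \<kappa>" "b \<kappa>"]) auto
qed

section \<open>Fields on the corridor\<close>

lemma mass_x_independent:
  assumes "0 < Lx" "x_independent Lx Ly f" and cont: "continuous_on {-Ly..Ly} (profile f)"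
  shows "mass Lx Ly f = 2 * Lx * integral {-Ly..Ly} (profile f)"
proof -
  have cbox: "corridor Lx Ly = cbox (-Lx, -Ly) (Lx, Ly)"
    by (simp add: corridor_def cbox_Pair_eq)
  have "mass Lx Ly f = integral (cbox (-Lx, -Ly) (Lx, Ly)) (\<lambda>z. profile f (snd z))"
    unfolding mass_def cbox
  proof (rule integral_cong)
    fix z assume "z \<in> cbox (-Lx, -Ly) (Lx, Ly)"
    then show "f z = profile f (snd z)"
      using assms(1,2) by (cases z) (auto simp: cbox_Pair_eq x_independent_def profile_def)
  qed
  also have "\<dots> = integral (cbox (-Lx) Lx) (\<lambda>x. integral (cbox (-Ly) Ly) (\<lambda>y. profile f (snd (x, y))))"
    by (intro integral_prod_continuous continuous_on_compose2[OF cont] continuous_intros)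
       (auto simp: cbox_Pair_eq)
  finally show ?thesis
    using assms(1) by simp
qed

theorem theorem1:
  fixes Lx Ly \<gamma>\<^sub>0 \<gamma>\<^sub>1 \<gamma>\<^sub>2 M :: real
  assumes "Lx > 0" and "Ly > 0"
    and "0 \<le> \<gamma>\<^sub>0" "\<gamma>\<^sub>0 \<le> 1" "0 \<le> \<gamma>\<^sub>1" "\<gamma>\<^sub>1 \<le> 1" "0 \<le> \<gamma>\<^sub>2" "\<gamma>\<^sub>2 \<le> 1"
    and "\<gamma>\<^sub>0 > 0" and "\<gamma>\<^sub>1 > \<gamma>\<^sub>2"
    and "0 < M" and "M < 2 * Lx * Ly"
  shows "(\<exists>r b. x_independent_stationary_state Lx Ly \<gamma>\<^sub>0 \<gamma>\<^sub>1 \<gamma>\<^sub>2 r b \<and>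
              mass Lx Ly r = M \<and> mass Lx Ly b = M \<and> \<not> trivial_state Ly r b) \<and>
         (\<forall>r b. x_independent_stationary_state Lx Ly \<gamma>\<^sub>0 \<gamma>\<^sub>1 \<gamma>\<^sub>2 r b \<longrightarrow>
              mass Lx Ly r = M \<longrightarrow> mass Lx Ly b = M \<longrightarrow> weak_lane_formation Ly r b)"
proof
  define m where "m = M / (2 * Lx)"
  have Lx: "0 < Lx" and Ly: "0 < Ly" and \<gamma>\<^sub>0: "0 < \<gamma>\<^sub>0" and mobility: "0 < \<gamma>\<^sub>1 + \<gamma>\<^sub>2"
    and m: "0 < m" "m < Ly" and M: "M = 2 * Lx * m"
    using assms by (auto simp: m_def field_simps)
  have mass_eq: "mass Lx Ly r = 2 * Lx * integral {-Ly..Ly} (profile r) \<and>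
      mass Lx Ly b = 2 * Lx * integral {-Ly..Ly} (profile b)"
    if "x_independent_stationary_state Lx Ly \<gamma>\<^sub>0 \<gamma>\<^sub>1 \<gamma>\<^sub>2 r b" for r b
  proof -
    interpret stationary_pair Ly \<gamma>\<^sub>0 \<gamma>\<^sub>1 \<gamma>\<^sub>2 "profile r" "profile b"
      using Ly \<gamma>\<^sub>0 mobility that by unfold_locales (auto simp: x_independent_stationary_state_def)
    show ?thesis
      using that continuous_r continuous_b Lx
      by (auto simp: x_independent_stationary_state_def intro!: mass_x_independent)
  qed
  show "\<exists>r b. x_independent_stationary_state Lx Ly \<gamma>\<^sub>0 \<gamma>\<^sub>1 \<gamma>\<^sub>2 r b \<and>
              mass Lx Ly r = M \<and> mass Lx Ly b = M \<and> \<not> trivial_state Ly r b"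
  proof -
    obtain r b where stat: "stationary_profile Ly \<gamma>\<^sub>0 \<gamma>\<^sub>1 \<gamma>\<^sub>2 r b"
        and int: "integral {-Ly..Ly} r = m" "integral {-Ly..Ly} b = m"
      using stationary_profile_with_mass[OF Ly \<gamma>\<^sub>0 mobility m] by blast
    define R B :: "real \<times> real \<Rightarrow> real" where "R = (\<lambda>z. r (snd z))" and "B = (\<lambda>z. b (snd z))"
    have profiles: "profile R = r" "profile B = b"
      by (simp_all add: profile_def R_def B_def)
    have state: "x_independent_stationary_state Lx Ly \<gamma>\<^sub>0 \<gamma>\<^sub>1 \<gamma>\<^sub>2 R B"
      unfolding x_independent_stationary_state_def profiles
      using stat by (simp add: x_independent_def R_def B_def)
    have "\<not> trivial_state Ly R B"
    proof
      assume "trivial_state Ly R B"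
      then obtain p where p: "(\<lambda>y. (r y, b y)) ` {-Ly..Ly} = {p}" "fst p = 0 \<or> snd p = 0"
        unfolding trivial_state_def profiles by auto
      have "(r y, b y) = p" if "y \<in> {-Ly..Ly}" for y
        using p(1) that by blast
      then have "(\<forall>y\<in>{-Ly..Ly}. r y = 0) \<or> (\<forall>y\<in>{-Ly..Ly}. b y = 0)"
        using p(2) by force
      then have "integral {-Ly..Ly} r = 0 \<or> integral {-Ly..Ly} b = 0"
        using integral_cong[of "{-Ly..Ly}" r "\<lambda>y. 0"] integral_cong[of "{-Ly..Ly}" b "\<lambda>y. 0"] by auto
      then show False
        using int m by simp
    qed
    moreover have "mass Lx Ly R = M" "mass Lx Ly B = M"
      using mass_eq[OF state] int by (simp_all add: profiles M)
    ultimately show ?thesis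
      using state by blast
  qed
  show "\<forall>r b. x_independent_stationary_state Lx Ly \<gamma>\<^sub>0 \<gamma>\<^sub>1 \<gamma>\<^sub>2 r b \<longrightarrow>
              mass Lx Ly r = M \<longrightarrow> mass Lx Ly b = M \<longrightarrow> weak_lane_formation Ly r b"
  proof (intro allI impI)
    fix r b
    assume state: "x_independent_stationary_state Lx Ly \<gamma>\<^sub>0 \<gamma>\<^sub>1 \<gamma>\<^sub>2 r b"
      and masses: "mass Lx Ly r = M" "mass Lx Ly b = M"
    interpret stationary_pair Ly \<gamma>\<^sub>0 \<gamma>\<^sub>1 \<gamma>\<^sub>2 "profile r" "profile b"
      using Ly \<gamma>\<^sub>0 mobility state by unfold_locales (auto simp: x_independent_stationary_state_def)
    have "integral {-Ly..Ly} (profile r) = m" "integral {-Ly..Ly} (profile b) = m"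
      using mass_eq[OF state] masses Lx by (simp_all add: M)
    then show "weak_lane_formation Ly r b"
      unfolding weak_lane_formation_def
      using smooth_r smooth_b densities_monotone densities_cross m by simp
  qed
qed

end
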